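(* Let $\chi$ denote the lowest eigenvalue of the symmetric positive definite matrix $\mathbf{J}=\begin{pmatrix}R_0&R_1\\R_1&R_2\end{pmatrix}$, so that $\chi>0$. Then the function $(\boldsymbol{v},\boldsymbol{h})\mapsto\Phi(\boldsymbol{v},\boldsymbol{h};\boldsymbol{\mathcal{L}})$ is $\mu$-strongly convex with respect to the variables $(\boldsymbol{v},\boldsymbol{h})\in\mathbb{R}^{|\Upsilon|}\times\mathbb{R}^{|\Upsilon|}$, with $\mu=\chi$.
   Context: Let $N\geq 2$, $\Upsilon=\{1,\dots,N\}^2$, and let $j_1<j_2$ be positive integers; all sums $\sum_j$ are over $j\in\{j_1,\dots,j_2\}$. For each $j$ let $\boldsymbol{\mathcal{L}}_j=(\mathcal{L}_{j,\underline{n}})_{\underline{n}\in\Upsilon}$ be given with $\mathcal{L}_{j,\underline{n}}>0$, and let $\log_2$ act entrywise. Set $R_m=\sum_j j^m$ for $m=0,1,2$, and $$\Phi(\boldsymbol{v},\boldsymbol{h};\boldsymbol{\mathcal{L}})=\frac12\sum_j\|\boldsymbol{v}+j\boldsymbol{h}-\log_2\boldsymbol{\mathcal{L}}_j\|_{\mathrm{Fro}}^2,\qquad \boldsymbol{v},\boldsymbol{h}\in\mathbb{R}^{|\Upsilon|},$$ where $\|\cdot\|_{\mathrm{Fro}}$ is the Frobenius (Euclidean) norm on $\mathbb{R}^{|\Upsilon|}\cong\mathbb{R}^{N\times N}$. A function $\varphi:\mathcal{H}\to\mathbb{R}$ on a Hilbert space is $\mu$-strongly convex, for $\mu>0$,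 if $y\mapsto\varphi(y)-\frac{\mu}{2}\|y\|^2$ is convex. The space $\mathbb{R}^{|\Upsilon|}\times\mathbb{R}^{|\Upsilon|}$ carries its Euclidean norm. *)

theory Defs
  imports "HOL-Analysis.Analysis" "Jordan_Normal_Form.Spectral_Radius"
begin

(* "$" below is component access in real ^ 'n. *)
no_notation Matrix.vec_index (infixl "$" 100)

definition strongly_convex :: "real \<Rightarrow> ('a::{real_inner, complete_space} \<Rightarrow> real) \<Rightarrow> bool" where
  "strongly_convex \<mu> \<phi> \<longleftrightarrow> 0 < \<mu> \<and> convex_on UNIV (\<lambda>y. \<phi> y - \<mu> / 2 * (norm y)\<^sup>2)"

definition symmetric_positive_definite :: "real mat \<Rightarrow> bool" where
  "symmetric_positive_definite A \<longleftrightarrow>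
     square_mat A \<and> transpose_mat A = A \<and>
     (\<forall>x\<in>carrier_vec (dim_row A). x \<noteq> 0\<^sub>v (dim_row A) \<longrightarrow> 0 < scalar_prod x (A *\<^sub>v x))"

definition log2_entrywise :: "real ^ 'n ^ 'n \<Rightarrow> real ^ 'n ^ 'n" where
  "log2_entrywise X = (\<chi> a b. log 2 (X $ a $ b))"

definition R_sum :: "nat \<Rightarrow> nat \<Rightarrow> nat \<Rightarrow> real" where
  "R_sum j1 j2 m = (\<Sum>j = j1..j2. real j ^ m)"

definition J_mat :: "nat \<Rightarrow> nat \<Rightarrow> real mat" where
  "J_mat j1 j2 = mat_of_rows_list 2
     [[R_sum j1 j2 0, R_sum j1 j2 1],
      [R_sum j1 j2 1, R_sum j1 j2 2]]"

(* N is CARD('n); the norm of real ^ 'n ^ 'n is the l2-norm of the l2-norms of the rows,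
   i.e. the Frobenius norm (and not the operator norm). *)
definition Phi ::
  "nat \<Rightarrow> nat \<Rightarrow> (nat \<Rightarrow> real ^ 'n ^ 'n) \<Rightarrow> real ^ 'n ^ 'n \<Rightarrow> real ^ 'n ^ 'n \<Rightarrow> real" where
  "Phi j1 j2 L v h =
     1 / 2 * (\<Sum>j = j1..j2. (norm (v + real j *\<^sub>R h - log2_entrywise (L j)))\<^sup>2)"

end

theory Submission
  imports Defs
begin

text \<open>
  The number \<open>Phi v h\<close> is half a sum of squared distances, so its second-order part at a
  displacement \<open>(v, h)\<close> is half of
  \<open>\<Sum>j. \<parallel>v + j h\<parallel>\<^sup>2 = R\<^sub>0 \<parallel>v\<parallel>\<^sup>2 + 2 R\<^sub>1 \<langle>v, h\<rangle> + R\<^sub>2 \<parallel>h\<parallel>\<^sup>2\<close>, the quadratic form of \<open>J\<close> with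
  vectors in place of scalars. The lowest eigenvalue \<open>\<chi>\<close> of \<open>J\<close> satisfies
  \<open>(R\<^sub>0 - \<chi>) (R\<^sub>2 - \<chi>) = R\<^sub>1\<^sup>2\<close> with both factors nonnegative, so Cauchy--Schwarz bounds this form
  from below by \<open>\<chi> (\<parallel>v\<parallel>\<^sup>2 + \<parallel>h\<parallel>\<^sup>2)\<close> (lemma \<open>symmetric_form_lower_bound\<close>). Strong convexity
  follows because the convexity defect of a squared norm at \<open>p, q\<close> with weight \<open>t\<close> is exactly
  \<open>t (1 - t) \<parallel>p - q\<parallel>\<^sup>2\<close>.

  For scalars the same form is \<open>\<Sum>j. (x + j y)\<^sup>2\<close>; it vanishes only if \<open>x + j y = 0\<close> for two distinct
  values of \<open>j\<close>, that is, only if \<open>x = y = 0\<close>. Hence \<open>J\<close> is positive definite and \<open>\<chi> > 0\<close>.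
\<close>

section \<open>Eigenvalues of symmetric two-by-two matrices\<close>

lemma dim_row_mat2: "dim_row (mat_of_rows_list 2 [r, s]) = 2"
  by (simp add: mat_of_rows_list_def)

lemma mat2_mult_vec:
  fixes v :: "real Matrix.vec"
  assumes "v \<in> carrier_vec 2"
  shows "mat_of_rows_list 2 [[a, b], [c, d]] *\<^sub>v v
    = vec_of_list [a * vec_index v 0 + b * vec_index v 1, c * vec_index v 0 + d * vec_index v 1]"
  using assms
  by (intro eq_vecI) (auto simp: mat_of_rows_list_def scalar_prod_def less_Suc_eq numeral_2_eq_2)

lemma eigenvalue_symmetric_mat2_iff:
  fixes a b d k :: real
  shows "eigenvalue (mat_of_rows_list 2 [[a, b], [b, d]]) k \<longleftrightarrow> (a - k) * (d - k) = b\<^sup>2"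
    (is "eigenvalue ?A k \<longleftrightarrow> _")
proof
  assume "eigenvalue ?A k"
  then obtain v where v: "v \<in> carrier_vec 2" "v \<noteq> 0\<^sub>v 2" and Av: "?A *\<^sub>v v = k \<cdot>\<^sub>v v"
    by (auto simp: eigenvalue_def eigenvector_def dim_row_mat2)
  define x y where "x = vec_index v 0" and "y = vec_index v 1"
  have ev: "vec_of_list [a * x + b * y, b * x + d * y] = k \<cdot>\<^sub>v v"
    using mat2_mult_vec[OF v(1), of a b b d] Av by (simp add: x_def y_def)
  have 1: "a * x + b * y = k * x"
    using arg_cong[OF ev, of "\<lambda>w. vec_index w 0"] v(1) by (simp add: x_def)
  have 2: "b * x + d * y = k * y"
    using arg_cong[OF ev, of "\<lambda>w. vec_index w 1"] v(1) by (simp add: y_def)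
  have "x \<noteq> 0 \<or> y \<noteq> 0"
  proof (rule ccontr)
    assume "\<not> (x \<noteq> 0 \<or> y \<noteq> 0)"
    then have "v = 0\<^sub>v 2"
      using v(1) by (intro eq_vecI) (auto simp: x_def y_def less_2_cases_iff)
    with v(2) show False by simp
  qed
  moreover have "x * ((a - k) * (d - k) - b\<^sup>2)
      = (d - k) * (a * x + b * y - k * x) - b * (b * x + d * y - k * y)"
    by (simp add: algebra_simps power2_eq_square)
  then have "x * ((a - k) * (d - k) - b\<^sup>2) = 0"
    by (simp add: 1 2)
  moreover have "y * ((a - k) * (d - k) - b\<^sup>2)
      = (a - k) * (b * x + d * y - k * y) - b * (a * x + b * y - k * x)"
    by (simp add: algebra_simps power2_eq_square)
  then have "y * ((a - k) * (d - k) - b\<^sup>2) = 0"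
    by (simp add: 1 2)
  ultimately show "(a - k) * (d - k) = b\<^sup>2" by auto
next
  assume root: "(a - k) * (d - k) = b\<^sup>2"
  \<comment> \<open>The vector \<open>(b, k - a)\<close> is orthogonal to the first row of \<open>A - k\<close>; if it vanishes, that row is
    zero and \<open>(1, 0)\<close> is an eigenvector.\<close>
  obtain x y :: real where xy: "x \<noteq> 0 \<or> y \<noteq> 0"
    and 1: "a * x + b * y = k * x" and 2: "b * x + d * y = k * y"
  proof (cases "b = 0 \<and> k = a")
    case True
    then show thesis by (intro that[of 1 0]) auto
  next
    case False
    then have "b \<noteq> 0 \<or> k - a \<noteq> 0" by auto
    moreover have "a * b + b * (k - a) = k * b"
      by (simp add: algebra_simps)
    moreover have "b * b + d * (k - a) = k * (k - a)"
      using root by (simp add: algebra_simps power2_eq_square)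
    ultimately show thesis by (rule that)
  qed
  let ?v = "vec_of_list [x, y]"
  have v: "?v \<in> carrier_vec 2" by (rule carrier_vecI) simp
  have "?v \<noteq> 0\<^sub>v 2"
  proof
    assume *: "?v = 0\<^sub>v 2"
    have "x = 0" using arg_cong[OF *, of "\<lambda>w. vec_index w 0"] by simp
    moreover have "y = 0" using arg_cong[OF *, of "\<lambda>w. vec_index w 1"] by simp
    ultimately show False using xy by simp
  qed
  moreover have "?A *\<^sub>v ?v = k \<cdot>\<^sub>v ?v"
    unfolding mat2_mult_vec[OF v] using 1 2
    by (intro eq_vecI) (auto simp: less_Suc_eq numeral_2_eq_2)
  ultimately show "eigenvalue ?A k"
    using v by (auto simp: eigenvalue_def eigenvector_def dim_row_mat2)
qed

text \<open>
  The two eigenvalues are \<open>(a + d \<plusminus> sqrt ((a - d)\<^sup>2 + 4 b\<^sup>2)) / 2\<close>. The lowest one lies below both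
  diagonal entries because the square root dominates \<open>\<bar>a - d\<bar>\<close>.
\<close>

lemma Min_spectrum_symmetric_mat2:
  fixes a b d :: real
  defines "A \<equiv> mat_of_rows_list 2 [[a, b], [b, d]]"
  defines "m \<equiv> Min (spectrum A)"
  shows "m \<in> spectrum A" "(a - m) * (d - m) = b\<^sup>2" "m \<le> a" "m \<le> d"
proof -
  define s where "s = sqrt ((a - d)\<^sup>2 + 4 * b\<^sup>2)"
  have s2: "s\<^sup>2 = (a - d)\<^sup>2 + 4 * b\<^sup>2" by (simp add: s_def)
  have s_ge: "\<bar>a - d\<bar> \<le> s"
    unfolding s_def by (rule real_le_rsqrt) simp
  have "(a - k) * (d - k) = b\<^sup>2 \<longleftrightarrow> k = (a + d - s) / 2 \<or> k = (a + d + s) / 2" for k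
  proof -
    have "(a - k) * (d - k) - b\<^sup>2 = (k - (a + d - s) / 2) * (k - (a + d + s) / 2)"
      using s2 by (simp add: field_simps power2_eq_square)
    then show ?thesis
      by (metis eq_iff_diff_eq_0 mult_eq_0_iff)
  qed
  then have spec: "spectrum A = {(a + d - s) / 2, (a + d + s) / 2}"
    by (auto simp: spectrum_def A_def eigenvalue_symmetric_mat2_iff)
  show mem: "m \<in> spectrum A"
    unfolding m_def by (rule Min_in) (auto simp: spec)
  then show "(a - m) * (d - m) = b\<^sup>2"
    by (simp add: spectrum_def A_def eigenvalue_symmetric_mat2_iff)
  have "m = (a + d - s) / 2"
    unfolding m_def spec using s_ge by simp
  then show "m \<le> a" and "m \<le> d"
    using s_ge by (auto simp: abs_le_iff)
qed

section \<open>The quadratic form with vector arguments\<close>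

lemma symmetric_form_lower_bound:
  fixes a b d m :: real and v h :: "'a::real_inner"
  assumes "(a - m) * (d - m) = b\<^sup>2" "m \<le> a" "m \<le> d"
  shows "m * ((norm v)\<^sup>2 + (norm h)\<^sup>2) \<le> a * (norm v)\<^sup>2 + 2 * b * inner v h + d * (norm h)\<^sup>2"
proof -
  define p q where "p = sqrt (a - m)" and "q = sqrt (d - m)"
  have p: "p\<^sup>2 = a - m" and q: "q\<^sup>2 = d - m"
    using assms by (auto simp: p_def q_def)
  have "p * q = \<bar>b\<bar>"
    unfolding p_def q_def by (simp flip: real_sqrt_mult add: assms(1))
  have "\<bar>b * inner v h\<bar> \<le> \<bar>b\<bar> * (norm v * norm h)"
    by (simp add: abs_mult mult_left_mono Cauchy_Schwarz_ineq2)
  also have "\<dots> = (p * norm v) * (q * norm h)"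
    by (simp flip: \<open>p * q = \<bar>b\<bar>\<close>)
  finally have cs: "\<bar>b * inner v h\<bar> \<le> (p * norm v) * (q * norm h)" .
  have "0 \<le> (p * norm v - q * norm h)\<^sup>2" by simp
  also have "\<dots> = (a - m) * (norm v)\<^sup>2 - 2 * ((p * norm v) * (q * norm h)) + (d - m) * (norm h)\<^sup>2"
    by (simp add: power2_diff power_mult_distrib p q)
  finally show ?thesis
    using cs by (simp add: algebra_simps abs_le_iff)
qed

lemma sum_norm_affine_squared:
  fixes v h :: "'a::real_inner"
  shows "(\<Sum>j = j1..j2. (norm (v + real j *\<^sub>R h))\<^sup>2)
    = R_sum j1 j2 0 * (norm v)\<^sup>2 + 2 * R_sum j1 j2 1 * inner v h + R_sum j1 j2 2 * (norm h)\<^sup>2"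
proof -
  have "(norm (v + real j *\<^sub>R h))\<^sup>2
      = (norm v)\<^sup>2 + 2 * real j * inner v h + (real j)\<^sup>2 * (norm h)\<^sup>2" for j
    unfolding power2_norm_eq_inner
    by (simp add: inner_add_left inner_add_right inner_commute power2_eq_square algebra_simps)
  then show ?thesis
    by (simp add: R_sum_def sum.distrib sum_distrib_left sum_distrib_right)
qed

section \<open>Positive definiteness\<close>

lemma symmetric_positive_definite_J_mat:
  assumes "j1 < j2"
  shows "symmetric_positive_definite (J_mat j1 j2)"
  unfolding symmetric_positive_definite_def
proof (intro conjI ballI impI)
  show "square_mat (J_mat j1 j2)"
    by (simp add: J_mat_def mat_of_rows_list_def)
  show "transpose_mat (J_mat j1 j2) = J_mat j1 j2"
    by (rule eq_matI) (auto simp: J_mat_def mat_of_rows_list_def less_Suc_eq numeral_2_eq_2)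
  fix v :: "real Matrix.vec"
  assume "v \<in> carrier_vec (dim_row (J_mat j1 j2))" "v \<noteq> 0\<^sub>v (dim_row (J_mat j1 j2))"
  then have v: "v \<in> carrier_vec 2" "v \<noteq> 0\<^sub>v 2"
    by (simp_all add: J_mat_def dim_row_mat2)
  define x y where "x = vec_index v 0" and "y = vec_index v 1"
  have "scalar_prod v (J_mat j1 j2 *\<^sub>v v)
      = R_sum j1 j2 0 * (norm x)\<^sup>2 + 2 * R_sum j1 j2 1 * inner x y + R_sum j1 j2 2 * (norm y)\<^sup>2"
    unfolding J_mat_def mat2_mult_vec[OF v(1)]
    using v(1) by (simp add: scalar_prod_def x_def y_def power2_eq_square algebra_simps)
  also have "\<dots> = (\<Sum>j = j1..j2. (x + real j * y)\<^sup>2)"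
    using sum_norm_affine_squared[of x y j1 j2] by simp
  also have "\<dots> > 0"
  proof (rule ccontr)
    assume "\<not> (\<Sum>j = j1..j2. (x + real j * y)\<^sup>2) > 0"
    then have "(\<Sum>j = j1..j2. (x + real j * y)\<^sup>2) = 0"
      by (simp add: sum_nonneg order.antisym not_less)
    then have "\<forall>j\<in>{j1..j2}. (x + real j * y)\<^sup>2 = 0"
      by (subst (asm) sum_nonneg_eq_0_iff) auto
    then have 1: "x + real j1 * y = 0" and 2: "x + real j2 * y = 0"
      using assms by auto
    then have "(real j2 - real j1) * y = 0"
      unfolding left_diff_distrib by linarith
    then have "y = 0" using assms by simp
    with 1 have "x = 0" by simp
    with \<open>y = 0\<close> have "v = 0\<^sub>v 2"
      using v(1) by (intro eq_vecI) (auto simp: x_def y_def less_2_cases_iff)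
    with v(2) show False by simp
  qed
  finally show "0 < scalar_prod v (J_mat j1 j2 *\<^sub>v v)" .
qed

lemma symmetric_positive_definite_eigenvalue_pos:
  assumes "symmetric_positive_definite A" "k \<in> spectrum A"
  shows "0 < k"
proof -
  obtain v where v: "v \<in> carrier_vec (dim_row A)" "v \<noteq> 0\<^sub>v (dim_row A)"
    and Av: "A *\<^sub>v v = k \<cdot>\<^sub>v v"
    using assms(2) by (auto simp: spectrum_def eigenvalue_def eigenvector_def)
  have "0 < scalar_prod v (k \<cdot>\<^sub>v v)"
    using assms(1) v by (auto simp: symmetric_positive_definite_def simp flip: Av)
  also have "\<dots> = k * scalar_prod v v"
    using v(1) by simp
  finally have "0 < k * scalar_prod v v" .
  moreover have "0 \<le> scalar_prod v v"
    by (auto simp: scalar_prod_def intro!: sum_nonneg)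
  ultimately show ?thesis
    by (metis mult_nonneg_nonneg mult_nonpos_nonneg not_less)
qed

section \<open>Convexity\<close>

lemma norm_squared_convexity_defect:
  fixes p q :: "'a::real_inner"
  shows "(1 - t) * (norm p)\<^sup>2 + t * (norm q)\<^sup>2 - (norm ((1 - t) *\<^sub>R p + t *\<^sub>R q))\<^sup>2
    = t * (1 - t) * (norm (p - q))\<^sup>2"
  by (simp add: power2_norm_eq_inner inner_add_left inner_add_right inner_diff_left
      inner_diff_right inner_commute algebra_simps)

lemma convex_on_Phi_diff:
  fixes L :: "nat \<Rightarrow> real ^ 'n ^ 'n"
  assumes "\<And>v h :: real ^ 'n ^ 'n.
    m * ((norm v)\<^sup>2 + (norm h)\<^sup>2) \<le> (\<Sum>j = j1..j2. (norm (v + real j *\<^sub>R h))\<^sup>2)"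
  shows "convex_on UNIV (\<lambda>y. (case y of (v, h) \<Rightarrow> Phi j1 j2 L v h) - m / 2 * (norm y)\<^sup>2)"
proof (rule convex_onI)
  fix t :: real and y z :: "(real ^ 'n ^ 'n) \<times> (real ^ 'n ^ 'n)"
  assume t: "0 < t" "t < 1"
  obtain v h v' h' where y: "y = (v, h)" and z: "z = (v', h')"
    by fastforce
  define e where "e u g j = u + real j *\<^sub>R g - log2_entrywise (L j)" for u g :: "real ^ 'n ^ 'n" and j
  let ?w = "(1 - t) *\<^sub>R v + t *\<^sub>R v'" and ?g = "(1 - t) *\<^sub>R h + t *\<^sub>R h'"
  have e_comb: "e ?w ?g j = (1 - t) *\<^sub>R e v h j + t *\<^sub>R e v' h' j" for j
    by (simp add: e_def algebra_simps)
  have e_diff: "e v h j - e v' h' j = (v - v') + real j *\<^sub>R (h - h')" for j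
    by (simp add: e_def algebra_simps)
  have Phi_e: "Phi j1 j2 L u g = 1 / 2 * (\<Sum>j = j1..j2. (norm (e u g j))\<^sup>2)" for u g
    by (simp add: Phi_def e_def)
  have "(1 - t) * Phi j1 j2 L v h + t * Phi j1 j2 L v' h' - Phi j1 j2 L ?w ?g
      = 1 / 2 * (\<Sum>j = j1..j2. (1 - t) * (norm (e v h j))\<^sup>2 + t * (norm (e v' h' j))\<^sup>2
          - (norm (e ?w ?g j))\<^sup>2)"
    by (simp add: Phi_e sum.distrib sum_subtractf field_simps flip: sum_distrib_left)
  also have "\<dots> = t * (1 - t) / 2 * (\<Sum>j = j1..j2. (norm ((v - v') + real j *\<^sub>R (h - h')))\<^sup>2)"
    by (simp only: e_comb norm_squared_convexity_defect e_diff flip: sum_distrib_left) simp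
  also have "\<dots> \<ge> t * (1 - t) / 2 * (m * ((norm (v - v'))\<^sup>2 + (norm (h - h'))\<^sup>2))"
    using t by (intro mult_left_mono assms) auto
  also have "t * (1 - t) / 2 * (m * ((norm (v - v'))\<^sup>2 + (norm (h - h'))\<^sup>2))
      = m / 2 * (t * (1 - t) * (norm (y - z))\<^sup>2)"
    by (simp add: y z norm_Pair)
  also have "\<dots> = m / 2 * ((1 - t) * (norm y)\<^sup>2 + t * (norm z)\<^sup>2
      - (norm ((1 - t) *\<^sub>R y + t *\<^sub>R z))\<^sup>2)"
    by (simp only: norm_squared_convexity_defect)
  finally have defect: "m / 2 * ((1 - t) * (norm y)\<^sup>2 + t * (norm z)\<^sup>2
        - (norm ((1 - t) *\<^sub>R y + t *\<^sub>R z))\<^sup>2)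
      \<le> (1 - t) * Phi j1 j2 L v h + t * Phi j1 j2 L v' h' - Phi j1 j2 L ?w ?g" .
  have rearrange: "S - m / 2 * C \<le> (1 - t) * (P - m / 2 * A) + t * (Q - m / 2 * B)"
    if "m / 2 * ((1 - t) * A + t * B - C) \<le> (1 - t) * P + t * Q - S" for A B C P Q S :: real
    using that by (simp add: field_simps)
  show "(case (1 - t) *\<^sub>R y + t *\<^sub>R z of (v, h) \<Rightarrow> Phi j1 j2 L v h)
        - m / 2 * (norm ((1 - t) *\<^sub>R y + t *\<^sub>R z))\<^sup>2
      \<le> (1 - t) * ((case y of (v, h) \<Rightarrow> Phi j1 j2 L v h) - m / 2 * (norm y)\<^sup>2)
        + t * ((case z of (v, h) \<Rightarrow> Phi j1 j2 L v h) - m / 2 * (norm z)\<^sup>2)"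
    using rearrange[OF defect] by (simp add: y z)
qed simp

theorem proposition2:
  fixes j1 j2 :: nat
    and L :: "nat \<Rightarrow> real ^ 'n ^ 'n"
    and chi :: real
  assumes "CARD('n) \<ge> 2"
    and "0 < j1" and "j1 < j2"
    and "\<And>j a b. j \<in> {j1..j2} \<Longrightarrow> L j $ a $ b > 0"
    and "chi = Min (spectrum (J_mat j1 j2))"
  shows "symmetric_positive_definite (J_mat j1 j2)
    \<and> chi \<in> spectrum (J_mat j1 j2)
    \<and> chi > 0
    \<and> strongly_convex chi (\<lambda>(v, h). Phi j1 j2 L v h)"
proof -
  note chi = Min_spectrum_symmetric_mat2[of "R_sum j1 j2 0" "R_sum j1 j2 1" "R_sum j1 j2 2",
      folded J_mat_def, folded assms(5)]
  have pd: "symmetric_positive_definite (J_mat j1 j2)"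
    using \<open>j1 < j2\<close> by (rule symmetric_positive_definite_J_mat)
  have pos: "chi > 0"
    using pd chi(1) by (rule symmetric_positive_definite_eigenvalue_pos)
  have "convex_on UNIV (\<lambda>y. (case y of (v, h) \<Rightarrow> Phi j1 j2 L v h) - chi / 2 * (norm y)\<^sup>2)"
    by (rule convex_on_Phi_diff)
      (simp only: sum_norm_affine_squared symmetric_form_lower_bound[OF chi(2-4)])
  with pd chi(1) pos show ?thesis
    by (simp add: strongly_convex_def)
qed

end
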